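(* Let $b_1,\dots,b_n$ be positive integers, $b^*=\max\{b_1,\dots,b_n\}$, and let $(h_0([\mathbf b]),\dots,h_{r}([\mathbf b]))$ be the $h$-vector of $R_{[\mathbf b]}$, with $r=r_{[\mathbf b]}$ chosen so that $h_r([\mathbf b])\ne0$. Then (1) $r_{[\mathbf b]}=(b_1+\dots+b_n)-b^*$; (2) $h_{r_{[\mathbf b]}}([\mathbf b])=\binom{b^*}{b_1}\binom{b^*}{b_2}\cdots\binom{b^*}{b_n}$. In particular $h_{r_{[\mathbf b]}}([\mathbf b])=1$ if and only if $b_1=b_2=\dots=b_n$, in which case $r_{[\mathbf b]}=(n-1)b_1$; equivalently, $R_{[\mathbf b]}$ is Gorenstein if and only if $b_1=\dots=b_n$.
   Context: Let $K$ be a field, $[\mathbf b]=[b_1,\dots,b_n]$, $\mathcal M=\{0,\dots,b_1\}\times\dots\times\{0,\dots,b_n\}$, $S=K[T_v\mid v\in\mathcal M]$ standard graded, $\mathcal J_{[\mathbf b]}=\ker(T_v\mapsto x_{1,v_1}\cdots x_{n,v_n})$, and $R_{[\mathbf b]}=S/\mathcal J_{[\mathbf b]}$, a domain of Krull dimension $d=b_1+\dots+b_n+1$. The $h$-vector is defined by writing the Hilbert–Poincaré series $\sum_{l\ge0}\dim_K(R_{[\mathbf b]})_lt^l=\frac{\sum_k h_k([\mathbf b])t^k}{(1-t)^{d}}$. *)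

theory Defs
  imports "HOL-Computational_Algebra.Formal_Power_Series"
begin

text \<open>The variable x_{i,j} (0-based i < n, 0 \<le> j \<le> b_i) is indexed by the pair (i,j);
  a monomial in the x's is its exponent vector of type nat \<times> nat \<Rightarrow> nat.\<close>

definition lattice_pts :: "nat list \<Rightarrow> nat list set" where
  "lattice_pts b = {v. length v = length b \<and> (\<forall>i<length b. v ! i \<le> b ! i)}"

text \<open>Exponent vector of the image x_{1,v_1} ... x_{n,v_n} of T_v.\<close>
definition gen_exp :: "nat list \<Rightarrow> (nat \<times> nat \<Rightarrow> nat)" where
  "gen_exp v = (\<lambda>(i, j). if i < length v \<and> j = v ! i then 1 else 0)"

text \<open>R_[b] is (isomorphic to) the image of S in K[x_{i,j}], a monomial algebra.
  Its degree-l component is spanned by the (linearly independent) monomials that are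
  products of l generator images; so dim_K (R_[b])_l is the number of these monomials.\<close>
definition deg_monos :: "nat list \<Rightarrow> nat \<Rightarrow> (nat \<times> nat \<Rightarrow> nat) set" where
  "deg_monos b l = {(\<lambda>p. \<Sum>k<l. gen_exp (vs k) p) | vs. \<forall>k<l. vs k \<in> lattice_pts b}"

definition hilbert_fun :: "nat list \<Rightarrow> nat \<Rightarrow> nat" where
  "hilbert_fun b l = card (deg_monos b l)"

definition krull_dim :: "nat list \<Rightarrow> nat" where
  "krull_dim b = sum_list b + 1"

definition h_vec :: "nat list \<Rightarrow> nat \<Rightarrow> int" where
  "h_vec b k = fps_nth (Abs_fps (\<lambda>l. of_nat (hilbert_fun b l)) * (1 - fps_X) ^ krull_dim b) k"

end

theory Submission
  imports Defs "HOL-Library.FuncSet"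
begin

text \<open>The degree-l monomials of R_[b] are the exponent tables having degree l in each block
  of variables x_{i,0}, ..., x_{i,b_i}, so the Hilbert function is
  H(l) = prod_i C(l + b_i, b_i). This is a polynomial P(l) of degree d - 1, hence it is
  annihilated by the d-th backward difference, while h_k is the d-th backward difference
  at k of H extended by zero to the negative integers. Thus h_k = - (d-th difference of g)(k),
  where g equals P on the negative integers and vanishes elsewhere. For B = max b_i the
  polynomial P vanishes at -1, ..., -B, so g is supported on l \<le> -B-1; its d-th difference
  therefore vanishes beyond -B-1+d = sum b_i - B and takes there the value
  (-1)^d P(-B-1) = - prod_i C(B, b_i).\<close>

unbundle fps_syntax

definition multideg_monos :: "nat list \<Rightarrow> nat \<Rightarrow> (nat \<times> nat \<Rightarrow> nat) set" where
  "multideg_monos b l = {e. (\<forall>i j. e (i, j) \<noteq> 0 \<longrightarrow> i < length b \<and> j \<le> b ! i)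
                            \<and> (\<forall>i<length b. (\<Sum>j\<le>b ! i. e (i, j)) = l)}"

definition weak_comps :: "nat \<Rightarrow> nat \<Rightarrow> (nat \<Rightarrow> nat) set" where
  "weak_comps c l = {f. (\<forall>j. f j \<noteq> 0 \<longrightarrow> j \<le> c) \<and> (\<Sum>j\<le>c. f j) = l}"

lemma multideg_monosI:
  assumes "\<And>i j. e (i, j) \<noteq> 0 \<Longrightarrow> i < length b \<and> j \<le> b ! i"
    and "\<And>i. i < length b \<Longrightarrow> (\<Sum>j\<le>b ! i. e (i, j)) = l"
  shows "e \<in> multideg_monos b l"
  using assms by (simp add: multideg_monos_def)

lemma multideg_monosD:
  assumes "e \<in> multideg_monos b l"
  shows "\<And>i j. e (i, j) \<noteq> 0 \<Longrightarrow> i < length b \<and> j \<le> b ! i"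
    and "\<And>i. i < length b \<Longrightarrow> (\<Sum>j\<le>b ! i. e (i, j)) = l"
  using assms by (simp_all add: multideg_monos_def)

lemma deg_monos_subset_multideg_monos: "deg_monos b l \<subseteq> multideg_monos b l"
proof
  fix e assume "e \<in> deg_monos b l"
  then obtain vs where e: "e = (\<lambda>p. \<Sum>k<l. gen_exp (vs k) p)"
    and vs: "\<And>k. k < l \<Longrightarrow> length (vs k) = length b \<and> (\<forall>i<length b. vs k ! i \<le> b ! i)"
    unfolding deg_monos_def lattice_pts_def by blast
  have "i < length b \<and> j \<le> b ! i" if "e (i, j) \<noteq> 0" for i j
  proof -
    from that obtain k where "k < l" "gen_exp (vs k) (i, j) \<noteq> 0"
      unfolding e by (meson sum.not_neutral_contains_not_neutral lessThan_iff)
    then show ?thesis using vs[of k] by (auto simp: gen_exp_def split: if_splits)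
  qed
  moreover have "(\<Sum>j\<le>b ! i. e (i, j)) = l" if "i < length b" for i
  proof -
    have "(\<Sum>j\<le>b ! i. e (i, j)) = (\<Sum>k<l. \<Sum>j\<le>b ! i. gen_exp (vs k) (i, j))"
      unfolding e by (rule sum.swap)
    also have "\<dots> = (\<Sum>k<l. 1)"
      using vs that by (intro sum.cong) (auto simp: gen_exp_def)
    finally show ?thesis by simp
  qed
  ultimately show "e \<in> multideg_monos b l"
    by (rule multideg_monosI)
qed

lemma multideg_monos_Suc_split:
  assumes "e \<in> multideg_monos b (Suc l)"
  obtains v where "v \<in> lattice_pts b" and "\<And>p. gen_exp v p \<le> e p"
    and "(\<lambda>p. e p - gen_exp v p) \<in> multideg_monos b l"
proof -
  note supp = multideg_monosD(1)[OF assms] and rows = multideg_monosD(2)[OF assms]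
  have "\<exists>j\<le>b ! i. 0 < e (i, j)" if "i < length b" for i
    using rows[OF that] by (metis (no_types, lifting) atMost_iff gr0I nat.distinct(1) sum.neutral)
  then obtain J where J: "\<And>i. i < length b \<Longrightarrow> J i \<le> b ! i \<and> 0 < e (i, J i)"
    by metis
  define v where "v = map J [0..<length b]"
  have le: "gen_exp v p \<le> e p" for p
    using J by (cases p) (auto simp: gen_exp_def v_def Suc_le_eq)
  have "(\<Sum>j\<le>b ! i. e (i, j) - gen_exp v (i, j)) = l" if "i < length b" for i
  proof -
    have "(\<Sum>j\<le>b ! i. gen_exp v (i, j)) = 1"
      using J[OF that] that by (simp add: gen_exp_def v_def)
    then show ?thesis
      using rows[OF that] le by (simp add: sum_subtractf_nat)
  qed
  moreover have "i < length b \<and> j \<le> b ! i" if "e (i, j) - gen_exp v (i, j) \<noteq> 0" for i j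
    using supp[of i j] that by (metis diff_0_eq_0)
  ultimately have "(\<lambda>p. e p - gen_exp v p) \<in> multideg_monos b l"
    by (intro multideg_monosI)
  moreover have "v \<in> lattice_pts b"
    using J by (auto simp: v_def lattice_pts_def)
  ultimately show ?thesis
    using le that by blast
qed

lemma multideg_monos_subset_deg_monos: "multideg_monos b l \<subseteq> deg_monos b l"
proof (induction l)
  case 0
  have "e = (\<lambda>_. 0)" if "e \<in> multideg_monos b 0" for e
  proof
    fix p :: "nat \<times> nat"
    obtain i j where p: "p = (i, j)" by force
    show "e p = 0"
      using multideg_monosD(1)[OF that, of i j] multideg_monosD(2)[OF that, of i] unfolding p
      by (cases "e (i, j) = 0") auto
  qed
  moreover have "(\<lambda>_. 0) \<in> deg_monos b 0"
    by (simp add: deg_monos_def)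
  ultimately show ?case
    by blast
next
  case (Suc l)
  show ?case
  proof
    fix e assume "e \<in> multideg_monos b (Suc l)"
    then obtain v where v: "v \<in> lattice_pts b" and le: "\<And>p. gen_exp v p \<le> e p"
      and "(\<lambda>p. e p - gen_exp v p) \<in> multideg_monos b l"
      by (erule multideg_monos_Suc_split)
    with Suc.IH obtain vs where vs: "\<forall>k<l. vs k \<in> lattice_pts b"
      and e': "(\<lambda>p. e p - gen_exp v p) = (\<lambda>p. \<Sum>k<l. gen_exp (vs k) p)"
      unfolding deg_monos_def by blast
    have "e = (\<lambda>p. \<Sum>k<Suc l. gen_exp ((vs(l := v)) k) p)"
    proof
      fix p
      have "(\<Sum>k<Suc l. gen_exp ((vs(l := v)) k) p) = (\<Sum>k<l. gen_exp (vs k) p) + gen_exp v p"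
        by simp
      also have "\<dots> = e p"
        using fun_cong[OF e', of p] le[of p] by simp
      finally show "e p = (\<Sum>k<Suc l. gen_exp ((vs(l := v)) k) p)" ..
    qed
    moreover have "\<forall>k<Suc l. (vs(l := v)) k \<in> lattice_pts b"
      using vs v by (auto simp: less_Suc_eq)
    ultimately show "e \<in> deg_monos b (Suc l)"
      unfolding deg_monos_def by blast
  qed
qed

lemma deg_monos_eq_multideg_monos: "deg_monos b l = multideg_monos b l"
  using deg_monos_subset_multideg_monos multideg_monos_subset_deg_monos by blast

lemma card_weak_comps: "card (weak_comps c l) = (l + c) choose c"
proof -
  let ?L = "{xs::nat list. length xs = Suc c \<and> sum_list xs = l}"
  have sum_eq: "(\<Sum>j\<le>c. f j) = sum_list (map f [0..<Suc c])" for f :: "nat \<Rightarrow> nat"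
    by (induction c) (simp_all add: add_ac)
  have "bij_betw (\<lambda>f. map f [0..<Suc c]) (weak_comps c l) ?L"
  proof (rule bij_betw_byWitness[where f' = "\<lambda>xs j. if j \<le> c then xs ! j else 0"])
    show "\<forall>f\<in>weak_comps c l. (\<lambda>j. if j \<le> c then map f [0..<Suc c] ! j else 0) = f"
      by (auto simp: weak_comps_def fun_eq_iff less_Suc_eq_le nth_append)
    show "\<forall>xs\<in>?L. map (\<lambda>j. if j \<le> c then xs ! j else 0) [0..<Suc c] = xs"
      by (auto intro!: nth_equalityI simp del: upt_Suc simp: less_Suc_eq_le)
    show "(\<lambda>f. map f [0..<Suc c]) ` weak_comps c l \<subseteq> ?L"
      by (auto simp: weak_comps_def sum_eq)
    show "(\<lambda>xs j. if j \<le> c then xs ! j else 0) ` ?L \<subseteq> weak_comps c l"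
      by (auto simp: weak_comps_def sum_eq simp del: upt_Suc split: if_splits
          intro!: arg_cong[where f = sum_list] nth_equalityI)
  qed
  then have "card (weak_comps c l) = card ?L"
    by (rule bij_betw_same_card)
  also have "\<dots> = (l + c) choose c"
    using card_length_sum_list[of "Suc c" l] binomial_symmetric[of l "l + c"] by simp
  finally show ?thesis .
qed

lemma card_multideg_monos: "card (multideg_monos b l) = (\<Prod>c\<leftarrow>b. (l + c) choose c)"
proof -
  let ?n = "length b"
  have "bij_betw (\<lambda>e. \<lambda>i\<in>{..<?n}. \<lambda>j. e (i, j)) (multideg_monos b l)
          (\<Pi>\<^sub>E i\<in>{..<?n}. weak_comps (b ! i) l)"
    by (rule bij_betw_byWitness[where f' = "\<lambda>F (i, j). if i < ?n then F i j else 0"])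
      (auto simp: multideg_monos_def weak_comps_def fun_eq_iff PiE_iff extensional_def
        split: if_splits)
  then have "card (multideg_monos b l) = (\<Prod>i<?n. card (weak_comps (b ! i) l))"
    by (simp add: bij_betw_same_card card_PiE)
  also have "\<dots> = (\<Prod>c\<leftarrow>b. (l + c) choose c)"
    by (simp add: card_weak_comps prod.list_conv_set_nth atLeast0LessThan)
  finally show ?thesis .
qed

lemma hilbert_fun_eq: "hilbert_fun b l = (\<Prod>c\<leftarrow>b. (l + c) choose c)"
  by (simp add: hilbert_fun_def deg_monos_eq_multideg_monos card_multideg_monos)

definition bdiff :: "(int \<Rightarrow> 'a::ab_group_add) \<Rightarrow> int \<Rightarrow> 'a" where
  "bdiff f x = f x - f (x - 1)"

lemma bdiff_pow_Suc_right: "(bdiff ^^ Suc n) f = (bdiff ^^ n) (bdiff f)"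
  by (simp only: funpow_Suc_right o_apply)

lemma bdiff_pow_add: "(bdiff ^^ n) (\<lambda>x. f x + g x) = (\<lambda>x. (bdiff ^^ n) f x + (bdiff ^^ n) g x)"
  by (induction n) (auto simp: bdiff_def fun_eq_iff algebra_simps)

lemma bdiff_pow_diff: "(bdiff ^^ n) (\<lambda>x. f x - g x) = (\<lambda>x. (bdiff ^^ n) f x - (bdiff ^^ n) g x)"
  by (induction n) (auto simp: bdiff_def fun_eq_iff algebra_simps)

lemma bdiff_pow_zero: "(bdiff ^^ n) (\<lambda>_. 0) = (\<lambda>_. 0)"
  by (induction n) (auto simp: bdiff_def fun_eq_iff)

lemma bdiff_pow_shift: "(bdiff ^^ n) (\<lambda>x. f (x - 1)) = (\<lambda>x. (bdiff ^^ n) f (x - 1))"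
  by (induction n) (auto simp: bdiff_def fun_eq_iff)

lemma bdiff_pow_of_int: "(bdiff ^^ n) (\<lambda>x. of_int (f x)) = (\<lambda>x. of_int ((bdiff ^^ n) f x))"
  by (induction n) (auto simp: bdiff_def fun_eq_iff)

lemma bdiff_mult:
  fixes f g :: "int \<Rightarrow> 'a::comm_ring"
  shows "bdiff (\<lambda>x. f x * g x) = (\<lambda>x. bdiff f x * g x + f (x - 1) * bdiff g x)"
  by (auto simp: bdiff_def fun_eq_iff algebra_simps)

lemma bdiff_pow_mult_eq_0:
  fixes f g :: "int \<Rightarrow> 'a::comm_ring"
  assumes "(bdiff ^^ Suc m) f = (\<lambda>_. 0)" and "(bdiff ^^ Suc n) g = (\<lambda>_. 0)"
  shows "(bdiff ^^ Suc (m + n)) (\<lambda>x. f x * g x) = (\<lambda>_. 0)"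
  using assms
proof (induction "m + n" arbitrary: m n f g rule: less_induct)
  case less
  have "(bdiff ^^ Suc (m + n)) (\<lambda>x. f x * g x)
      = (\<lambda>x. (bdiff ^^ (m + n)) (\<lambda>x. bdiff f x * g x) x
           + (bdiff ^^ (m + n)) (\<lambda>x. f (x - 1) * bdiff g x) x)"
    by (simp only: bdiff_pow_Suc_right bdiff_mult bdiff_pow_add)
  also have "(bdiff ^^ (m + n)) (\<lambda>x. bdiff f x * g x) = (\<lambda>_. 0)"
  proof (cases m)
    case 0
    then show ?thesis using less.prems(1) by (simp add: bdiff_pow_zero)
  next
    case (Suc m')
    then have "(bdiff ^^ Suc m') (bdiff f) = (\<lambda>_. 0)"
      using less.prems(1) by (simp only: bdiff_pow_Suc_right)
    then show ?thesis using less.hyps[of m' n] less.prems(2) Suc by simp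
  qed
  also have "(bdiff ^^ (m + n)) (\<lambda>x. f (x - 1) * bdiff g x) = (\<lambda>_. 0)"
  proof (cases n)
    case 0
    then show ?thesis using less.prems(2) by (simp add: bdiff_pow_zero)
  next
    case (Suc n')
    then have "(bdiff ^^ Suc n') (bdiff g) = (\<lambda>_. 0)"
      using less.prems(2) by (simp only: bdiff_pow_Suc_right)
    moreover have "(bdiff ^^ Suc m) (\<lambda>x. f (x - 1)) = (\<lambda>_. 0)"
      by (simp only: bdiff_pow_shift less.prems(1))
    ultimately show ?thesis using less.hyps[of m n'] Suc by simp
  qed
  finally show ?case by simp
qed

lemma bdiff_pow_vanishing_above:
  fixes f :: "int \<Rightarrow> 'a::comm_ring_1"
  assumes "\<forall>x>y. f x = 0"
  shows "(bdiff ^^ d) f (y + int d) = (-1) ^ d * f y \<and> (\<forall>x > y + int d. (bdiff ^^ d) f x = 0)"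
  using assms
proof (induction d arbitrary: f y)
  case 0
  then show ?case by simp
next
  case (Suc d)
  have "\<forall>x > y + 1. bdiff f x = 0" and "bdiff f (y + 1) = - f y"
    using Suc.prems by (simp_all add: bdiff_def)
  with Suc.IH[of "y + 1" "bdiff f"] show ?case
    unfolding bdiff_pow_Suc_right by (simp add: add_ac)
qed

lemma fps_mult_one_minus_X_pow_nth:
  fixes A :: "'a::comm_ring_1 fps"
  shows "(A * (1 - fps_X) ^ d) $ k = (bdiff ^^ d) (\<lambda>x. if 0 \<le> x then A $ nat x else 0) (int k)"
proof (induction d arbitrary: k)
  case 0
  then show ?case by simp
next
  case (Suc d)
  define a where "a = (\<lambda>x::int. if 0 \<le> x then A $ nat x else 0)"
  have neg: "(bdiff ^^ d) a x = 0" if "x < 0" for x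
    using that by (induction d arbitrary: x) (auto simp: a_def bdiff_def)
  have "A * (1 - fps_X) ^ Suc d = A * (1 - fps_X) ^ d - fps_X * (A * (1 - fps_X) ^ d)"
    by (simp add: algebra_simps)
  then have "(A * (1 - fps_X) ^ Suc d) $ k
      = (A * (1 - fps_X) ^ d) $ k - (if k = 0 then 0 else (A * (1 - fps_X) ^ d) $ (k - 1))"
    by simp
  also have "\<dots> = (bdiff ^^ d) a (int k) - (bdiff ^^ d) a (int k - 1)"
    using Suc.IH[of k] Suc.IH[of "k - 1"] neg[of "-1"] by (cases "k = 0") (auto simp: a_def of_nat_diff)
  also have "\<dots> = (bdiff ^^ Suc d) a (int k)"
    by (simp add: bdiff_def)
  finally show ?case by (simp add: a_def)
qed

definition binom_poly :: "nat \<Rightarrow> int \<Rightarrow> rat" where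
  "binom_poly c x = (of_int x + of_nat c) gchoose c"

definition hilbert_poly :: "nat list \<Rightarrow> int \<Rightarrow> rat" where
  "hilbert_poly b x = (\<Prod>c\<leftarrow>b. binom_poly c x)"

lemma bdiff_binom_poly_Suc: "bdiff (binom_poly (Suc c)) = binom_poly c"
proof
  fix x
  have "binom_poly (Suc c) x = (of_int x + of_nat c + 1) gchoose Suc c"
    by (simp add: binom_poly_def add_ac)
  moreover have "binom_poly (Suc c) (x - 1) = (of_int x + of_nat c) gchoose Suc c"
    by (simp add: binom_poly_def)
  ultimately show "bdiff (binom_poly (Suc c)) x = binom_poly c x"
    by (simp add: bdiff_def gbinomial_Suc_Suc binom_poly_def)
qed

lemma bdiff_pow_binom_poly: "(bdiff ^^ Suc c) (binom_poly c) = (\<lambda>_. 0)"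
proof (induction c)
  case 0
  then show ?case by (simp add: binom_poly_def bdiff_def fun_eq_iff)
next
  case (Suc c)
  then show ?case by (simp only: bdiff_pow_Suc_right bdiff_binom_poly_Suc)
qed

lemma bdiff_pow_hilbert_poly: "(bdiff ^^ Suc (sum_list b)) (hilbert_poly b) = (\<lambda>_. 0)"
proof (induction b)
  case Nil
  then show ?case by (simp add: hilbert_poly_def bdiff_def fun_eq_iff)
next
  case (Cons c b)
  have "hilbert_poly (c # b) = (\<lambda>x. binom_poly c x * hilbert_poly b x)"
    by (simp add: hilbert_poly_def fun_eq_iff)
  then show ?case
    using bdiff_pow_mult_eq_0[OF bdiff_pow_binom_poly Cons.IH] by simp
qed

lemma hilbert_poly_of_nat: "hilbert_poly b (int l) = of_nat (\<Prod>c\<leftarrow>b. (l + c) choose c)"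
  by (induction b) (simp_all add: hilbert_poly_def binom_poly_def binomial_gbinomial)

lemma hilbert_poly_eq_0:
  assumes "B \<in> set b" and "- int B \<le> x" and "x < 0"
  shows "hilbert_poly b x = 0"
proof -
  define m where "m = nat (x + int B)"
  have "m < B" and "x + int B = int m"
    using assms(2,3) by (simp_all add: m_def)
  then have "of_int x + of_nat B = (of_nat m :: rat)"
    by (metis of_int_add of_int_of_nat_eq)
  then have "binom_poly B x = of_nat (m choose B)"
    by (simp add: binom_poly_def binomial_gbinomial)
  also have "\<dots> = 0"
    using \<open>m < B\<close> by simp
  finally have "binom_poly B x = 0" .
  then show ?thesis
    using assms(1) by (auto simp: hilbert_poly_def prod_list_zero_iff)
qed

lemma binom_poly_at_minus_Suc:
  assumes "c \<le> B"
  shows "binom_poly c (- int B - 1) = (-1) ^ c * of_nat (B choose c)"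
proof -
  have "of_int (- int B - 1) + of_nat c = (- of_nat (B + 1 - c) :: rat)"
    using assms by (simp add: of_nat_diff)
  then have "binom_poly c (- int B - 1) = (- of_nat (B + 1 - c) :: rat) gchoose c"
    by (simp only: binom_poly_def)
  also have "\<dots> = (-1) ^ c * ((of_nat (B + 1 - c) + of_nat c - 1) gchoose c)"
    by (rule gbinomial_minus)
  also have "\<dots> = (-1) ^ c * of_nat (B choose c)"
    using assms by (simp add: of_nat_diff binomial_gbinomial)
  finally show ?thesis .
qed

lemma hilbert_poly_at_minus_Suc:
  assumes "\<forall>c\<in>set b. c \<le> B"
  shows "hilbert_poly b (- int B - 1) = (-1) ^ sum_list b * of_nat (\<Prod>c\<leftarrow>b. B choose c)"
  using assms
proof (induction b)
  case (Cons c b)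
  then show ?case
    by (simp add: hilbert_poly_def binom_poly_at_minus_Suc power_add algebra_simps)
qed (simp add: hilbert_poly_def)

lemma h_vec_eq_bdiff_neg_part:
  "of_int (h_vec b k)
     = - (bdiff ^^ Suc (sum_list b)) (\<lambda>x. if 0 \<le> x then 0 else hilbert_poly b x) (int k)"
proof -
  let ?H = "Abs_fps (\<lambda>l. of_nat (hilbert_fun b l)) :: int fps"
  let ?g = "\<lambda>x. if 0 \<le> x then 0 else hilbert_poly b x"
  have "of_int (?H $ nat x) = hilbert_poly b x" if "0 \<le> x" for x
  proof -
    have "hilbert_poly b x = hilbert_poly b (int (nat x))"
      using that by simp
    also have "\<dots> = of_nat (hilbert_fun b (nat x))"
      by (simp only: hilbert_poly_of_nat hilbert_fun_eq)
    finally show ?thesis by simp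
  qed
  then have extension: "(\<lambda>x. of_int (if 0 \<le> x then ?H $ nat x else 0)) = (\<lambda>x. hilbert_poly b x - ?g x)"
    by (simp add: fun_eq_iff)
  have "h_vec b k = (bdiff ^^ Suc (sum_list b)) (\<lambda>x. if 0 \<le> x then ?H $ nat x else 0) (int k)"
    unfolding h_vec_def krull_dim_def Suc_eq_plus1 by (rule fps_mult_one_minus_X_pow_nth)
  then have "of_int (h_vec b k) = (bdiff ^^ Suc (sum_list b)) (\<lambda>x. hilbert_poly b x - ?g x) (int k)"
    by (simp only: bdiff_pow_of_int flip: extension)
  then show ?thesis
    by (simp only: bdiff_pow_diff bdiff_pow_hilbert_poly)
qed

lemma h_vec_top_degree:
  assumes "b \<noteq> []"
  defines "B \<equiv> Max (set b)"
  shows "h_vec b (sum_list b - B) = int (\<Prod>c\<leftarrow>b. B choose c)"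
    and "sum_list b - B < k \<Longrightarrow> h_vec b k = 0"
proof -
  have "B \<in> set b" and B_max: "\<forall>x\<in>set b. x \<le> B"
    using assms by (simp_all add: B_def)
  then have "B \<le> sum_list b"
    by (simp add: member_le_sum_list)
  define g where "g = (\<lambda>x. if 0 \<le> x then 0 else hilbert_poly b x)"
  define y where "y = - int B - 1"
  have "\<forall>x>y. g x = 0"
    using hilbert_poly_eq_0[OF \<open>B \<in> set b\<close>] by (auto simp: g_def y_def)
  from bdiff_pow_vanishing_above[OF this, of "Suc (sum_list b)"]
  have top: "(bdiff ^^ Suc (sum_list b)) g (int (sum_list b - B)) = (-1) ^ Suc (sum_list b) * g y"
    and above: "\<forall>x > int (sum_list b - B). (bdiff ^^ Suc (sum_list b)) g x = 0"
    using \<open>B \<le> sum_list b\<close> by (simp_all add: y_def of_nat_diff)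
  have "g y = (-1) ^ sum_list b * of_nat (\<Prod>c\<leftarrow>b. B choose c)"
    using hilbert_poly_at_minus_Suc[OF B_max] by (simp add: g_def y_def)
  then have "(of_int (h_vec b (sum_list b - B)) :: rat) = of_nat (\<Prod>c\<leftarrow>b. B choose c)"
    using top by (simp add: h_vec_eq_bdiff_neg_part flip: g_def power_add)
  then show "h_vec b (sum_list b - B) = int (\<Prod>c\<leftarrow>b. B choose c)"
    by (metis of_int_eq_iff of_int_of_nat_eq)
  show "h_vec b k = 0" if "sum_list b - B < k"
    using above that h_vec_eq_bdiff_neg_part[of b k] by (simp flip: g_def)
qed

lemma of_nat_prod_list: "of_nat (prod_list xs) = (\<Prod>x\<leftarrow>xs. of_nat x)"
  by (induction xs) auto

lemma binomial_eq_1_iff: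
  assumes "0 < k" and "k \<le> n"
  shows "n choose k = 1 \<longleftrightarrow> k = n"
proof
  assume "n choose k = 1"
  show "k = n"
  proof (rule ccontr)
    assume "k \<noteq> n"
    with assms obtain m j where "n = Suc m" "k = Suc j" "j < m"
      by (metis Suc_less_eq gr0_implies_Suc le_neq_implies_less less_imp_Suc_add)
    then have "n choose k = (m choose j) + (m choose Suc j)"
      and "0 < m choose j" and "0 < m choose Suc j"
      by simp_all
    with \<open>n choose k = 1\<close> show False
      by linarith
  qed
qed simp

lemma prod_list_binomial_eq_1_iff:
  assumes "\<forall>x\<in>set xs. 0 < x \<and> x \<le> n"
  shows "(\<Prod>x\<leftarrow>xs. n choose x) = 1 \<longleftrightarrow> (\<forall>x\<in>set xs. x = n)"
  using assms by (induction xs) (auto simp: binomial_eq_1_iff[unfolded One_nat_def])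

theorem mainTheorem5:
  fixes b :: "nat list"
  assumes "b \<noteq> []" and "\<forall>x\<in>set b. 0 < x"
  shows "h_vec b (sum_list b - Max (set b)) \<noteq> 0
       \<and> (\<forall>k > sum_list b - Max (set b). h_vec b k = 0)
       \<and> h_vec b (sum_list b - Max (set b)) = (\<Prod>x\<leftarrow>b. int (Max (set b) choose x))
       \<and> (h_vec b (sum_list b - Max (set b)) = 1 \<longleftrightarrow> (\<forall>x\<in>set b. x = hd b))
       \<and> ((\<forall>x\<in>set b. x = hd b) \<longrightarrow> sum_list b - Max (set b) = (length b - 1) * hd b)"
proof -
  define B where "B = Max (set b)"
  have "B \<in> set b" and B_max: "\<forall>x\<in>set b. x \<le> B"
    using assms(1) by (simp_all add: B_def)
  have "h_vec b (sum_list b - B) = int (\<Prod>x\<leftarrow>b. B choose x)"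
    using h_vec_top_degree(1)[OF assms(1)] by (simp add: B_def)
  moreover have "(\<Prod>x\<leftarrow>b. int (B choose x)) = int (\<Prod>x\<leftarrow>b. B choose x)"
    by (simp add: of_nat_prod_list o_def)
  moreover have "(\<Prod>x\<leftarrow>b. B choose x) \<noteq> 0"
    using B_max by (auto simp: prod_list_zero_iff)
  moreover have "(\<Prod>x\<leftarrow>b. B choose x) = 1 \<longleftrightarrow> (\<forall>x\<in>set b. x = B)"
    using assms(2) B_max by (intro prod_list_binomial_eq_1_iff) blast
  moreover have "(\<forall>x\<in>set b. x = hd b) \<longleftrightarrow> (\<forall>x\<in>set b. x = B)"
    using \<open>B \<in> set b\<close> hd_in_set[OF assms(1)] by metis
  moreover have "sum_list b - B = (length b - 1) * hd b" if "\<forall>x\<in>set b. x = hd b"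
    using that sum_list_replicate[of "length b" "hd b"] replicate_length_same[of b "hd b"]
      \<open>B \<in> set b\<close> by (simp add: diff_mult_distrib)
  ultimately show ?thesis
    using h_vec_top_degree(2)[OF assms(1)] unfolding B_def[symmetric] by simp
qed

end
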